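(* Let $c>0$ and $f\in\mathcal{F}_c$. Then the following hold. (a) $c\le 1/2$. (b) $f^{\sharp}(0)\le \dfrac{1+\sqrt{1-4c^2}}{2c}$. (c) $f^{\sharp}(0)\ge \dfrac{1-\sqrt{1-4c^2}}{2c}$. The equality cases are as follows. In (a): if $c=1/2$, then $f(z)=T(\eta z)$ for all $z \in \mathbb{D}$, for some rigid motion $T$ of the Riemann sphere and some $\eta\in\mathbb{C}$ with $|\eta|=1$; conversely, every function of this form belongs to $\mathcal{F}_{1/2}$. In (b): equality holds if and only if $f(z)=T(\eta z)$ for all $z\in\mathbb{D}$, for some rigid motion $T$ of the Riemann sphere and some $\eta\in\mathbb{C}$ with $|\eta|=\frac{1+\sqrt{1-4c^2}}{2c}$. In (c): equality holds if and only if $f(z)=T(\eta z)$ for all $z\in\mathbb{D}$, for some rigid motion $T$ of the Riemann sphere and some $\eta\in\mathbb{C}$ with $|\eta|=\frac{1-\sqrt{1-4c^2}}{2c}$. In particular, $\mathcal{F}_{1/2}$ is precisely the set of (restrictions to $\mathbb{D}$ of) rigid motions of the Riemann sphere.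
   Context: $\mathbb{D}=\{z\in\mathbb{C}:|z|<1\}$, and $\mathcal{M}(\mathbb{D})$ is the set of all meromorphic functions in $\mathbb{D}$. For $f\in\mathcal{M}(\mathbb{D})$ the spherical derivative is $f^{\sharp}(z)=\frac{|f'(z)|}{1+|f(z)|^2}$, extended continuously to the poles of $f$ (equivalently $f^\sharp=(1/f)^\sharp$ near a pole). For $c>0$, $\mathcal{F}_c=\{f\in\mathcal{M}(\mathbb{D}): f^{\sharp}(z)\ge c\text{ for all }z\in\mathbb{D}\}$. A rigid motion of the Riemann sphere $\hat{\mathbb{C}}=\mathbb{C}\cup\{\infty\}$ is a Möbius transformation of the form $T(z)=\frac{\alpha z+\beta}{-\overline{\beta}z+\overline{\alpha}}$ with $\alpha,\beta\in\mathbb{C}$, $|\alpha|^2+|\beta|^2=1$. *)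

theory Defs
  imports "HOL-Complex_Analysis.Complex_Analysis"
begin

abbreviation unit_disc :: "complex set" where
  "unit_disc \<equiv> ball 0 1"

(* Meromorphic functions on the disc are total functions complex => complex satisfying
   nicely_meromorphic_on: there are no removable singularities, and a pole (the sphere value
   infinity) carries the dummy value 0.  Whether a point of the disc is a pole is determined by
   the values at nearby points of the disc, so two such functions that agree on the disc
   also agree there as maps into the Riemann sphere. *)
definition meromorphic_functions_disc :: "(complex \<Rightarrow> complex) set" where
  "meromorphic_functions_disc = {f. f nicely_meromorphic_on unit_disc}"

definition spherical_deriv :: "(complex \<Rightarrow> complex) \<Rightarrow> complex \<Rightarrow> real" where
  "spherical_deriv f z =
     (if is_pole f z
      then Lim (at z) (\<lambda>w. cmod (deriv f w) / (1 + (cmod (f w))\<^sup>2))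
      else cmod (deriv f z) / (1 + (cmod (f z))\<^sup>2))"

definition spherical_class :: "real \<Rightarrow> (complex \<Rightarrow> complex) set" where
  "spherical_class c =
     {f \<in> meromorphic_functions_disc. \<forall>z\<in>unit_disc. spherical_deriv f z \<ge> c}"

(* Since x / 0 = 0, a rigid motion takes the value 0 at its finite pole, which is the
   convention for poles above; its numerator and denominator never vanish together. *)
definition rigid_motion :: "(complex \<Rightarrow> complex) \<Rightarrow> bool" where
  "rigid_motion T \<longleftrightarrow>
     (\<exists>\<alpha> \<beta>. (cmod \<alpha>)\<^sup>2 + (cmod \<beta>)\<^sup>2 = 1 \<and> T = moebius \<alpha> \<beta> (- cnj \<beta>) (cnj \<alpha>))"

end

theory Submission
  imports Defs
begin

text \<open>
  Suppose first that \<open>f 0 = 0\<close> and write \<open>a\<close> for the spherical derivative of \<open>f\<close> at 0. The reciprocal of the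
  spherical derivative is \<open>(1 + \<bar>f\<bar>\<^sup>2) / \<bar>f'\<bar> = \<bar>L\<bar> + \<bar>z\<bar>\<^sup>2 \<bar>K\<bar>\<close> with \<open>L = 1 / f'\<close> and \<open>K = f\<^sup>2 / (z\<^sup>2 f')\<close>. The
  lower bound \<open>c\<close> says that this sum is at most \<open>1 / c\<close>; in particular \<open>L\<close> and \<open>K\<close> have only removable
  singularities, at the poles of \<open>f\<close> as well as at 0. So both are holomorphic on the disc, with
  \<open>\<bar>L 0\<bar> = 1 / a\<close> and \<open>\<bar>K 0\<bar> = a\<close>.

  By the maximum principle on circles of radius close to 1, the weight \<open>\<bar>z\<bar>\<^sup>2\<close> may be dropped:
  \<open>\<bar>L\<bar> + \<bar>K\<bar> \<le> 1 / c\<close> on the whole disc (\<open>weighted_sum_bound_improves\<close>). At the centre this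
  reads \<open>a + 1 / a \<le> 1 / c\<close>, a quadratic inequality for \<open>a\<close> which is equivalent to the two bounds and
  which has a solution only if \<open>c \<le> 1/2\<close>. Equality at the centre forces \<open>L\<close> to be constant
  (\<open>weighted_sum_bound_rigid\<close>), so \<open>f'\<close> is constant and \<open>f\<close> is linear.

  A general \<open>f\<close> is brought to the normalization \<open>f 0 = 0\<close> by a rotation of the sphere
  (\<open>rotation_to_zero\<close>), which does not change the sum above. The two steps are combined in
  \<open>spherical_class_estimate\<close>. Conversely, the spherical derivative of a rigid motion \<open>T (\<eta> z)\<close> is
  \<open>\<bar>\<eta>\<bar> / (1 + \<bar>\<eta> z\<bar>\<^sup>2)\<close>, which gives membership in the class and the values at 0.
\<close>

section \<open>Spherical derivatives at ordinary points and at poles\<close>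

lemma spherical_deriv_cong:
  assumes "\<forall>\<^sub>F w in nhds z. f w = g w"
  shows   "spherical_deriv f z = spherical_deriv g z"
proof -
  let ?D = "\<lambda>h w. cmod (deriv h w) / (1 + (cmod (h w))\<^sup>2)"
  have "\<forall>\<^sub>F w in nhds z. \<forall>\<^sub>F v in nhds w. f v = g v"
    using assms by (simp add: eventually_eventually)
  hence eq: "\<forall>\<^sub>F w in nhds z. ?D f w = ?D g w"
  proof eventually_elim
    case (elim w)
    from deriv_cong_ev[OF elim refl] eventually_nhds_x_imp_x[OF elim] show ?case
      by simp
  qed
  hence "\<forall>\<^sub>F w in at z. ?D f w = ?D g w"
    by (simp add: eventually_nhds_conv_at)
  hence "(?D f \<longlongrightarrow> l) (at z) = (?D g \<longlongrightarrow> l) (at z)" for l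
    by (intro filterlim_cong refl)
  hence "Lim (at z) (?D f) = Lim (at z) (?D g)"
    unfolding Topological_Spaces.Lim_def by simp
  moreover have "is_pole f z = is_pole g z"
    using assms by (intro is_pole_cong) (auto simp: eventually_nhds_conv_at)
  ultimately show ?thesis
    using eventually_nhds_x_imp_x[OF eq] by (simp add: spherical_deriv_def)
qed

lemma nicely_meromorphic_on_cong_open:
  assumes "f nicely_meromorphic_on A" "open A" "\<And>z. z \<in> A \<Longrightarrow> f z = g z"
  shows   "g nicely_meromorphic_on A"
proof -
  have ev: "\<forall>\<^sub>F w in at z. f w = g w" if "z \<in> A" for z
    using eventually_at_in_open'[OF assms(2) that] by eventually_elim (use assms(3) in auto)
  have "g meromorphic_on A"
    using assms(1) meromorphic_on_cong[OF ev refl]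
    by (simp add: nicely_meromorphic_on_def)
  moreover have "(is_pole g z \<and> g z = 0) \<or> g \<midarrow>z\<rightarrow> g z" if z: "z \<in> A" for z
  proof -
    have "is_pole f z = is_pole g z"
      by (rule is_pole_cong[OF ev[OF z] refl])
    moreover have "(f \<midarrow>z\<rightarrow> f z) = (g \<midarrow>z\<rightarrow> g z)"
      using assms(3)[OF z] by (intro filterlim_cong ev z) auto
    ultimately show ?thesis
      using assms(1,3) z by (auto simp: nicely_meromorphic_on_def)
  qed
  ultimately show ?thesis
    by (auto simp: nicely_meromorphic_on_def)
qed

text \<open>
  The local coordinate at a pole. Since the value of \<open>f\<close> at the pole is the default 0 and
  \<open>inverse 0 = 0\<close>, the reciprocal is already analytic there without any correction.
\<close>
lemma analytic_reciprocal_at_pole: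
  assumes "f nicely_meromorphic_on {z}" "is_pole f z" and h_def: "h = (\<lambda>w. inverse (f w))"
  shows   "h analytic_on {z}" "h z = 0"
          "\<forall>\<^sub>F w in at z. h w \<noteq> 0 \<and> f w = inverse (h w) \<and> deriv f w = - deriv h w / (h w)\<^sup>2"
proof -
  have lim0: "h \<midarrow>z\<rightarrow> 0"
    using assms(2) unfolding is_pole_def h_def
    by (intro filterlim_compose[OF tendsto_inverse_0])
  have "\<not> is_pole h z"
    using lim0 not_tendsto_and_filterlim_at_infinity[of "at z" h 0] by (auto simp: is_pole_def)
  moreover have "h nicely_meromorphic_on {z}"
    unfolding h_def by (intro nicely_meromorphic_on_inverse assms)
  ultimately show "h analytic_on {z}"
    by (intro nicely_meromorphic_on_imp_analytic_at) auto
  show "h z = 0"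
    using is_pole_zero_at_nicely_mero[OF assms(1,2)] by (simp add: h_def)
  have "isolated_singularity_at f z"
    using assms(1) by (auto simp: nicely_meromorphic_on_def meromorphic_at_iff)
  hence "\<forall>\<^sub>F w in at z. f analytic_on {w}"
    using isolated_singularity_at_altdef by blast
  moreover have "\<forall>\<^sub>F w in at z. f w \<noteq> 0"
    using assms(2) non_zero_neighbour_pole by blast
  ultimately show "\<forall>\<^sub>F w in at z. h w \<noteq> 0 \<and> f w = inverse (h w) \<and>
                     deriv f w = - deriv h w / (h w)\<^sup>2"
  proof eventually_elim
    case (elim w)
    have "(f has_field_derivative deriv f w) (at w)"
      using elim(1) analytic_on_imp_differentiable_at DERIV_deriv_iff_field_differentiable by blast
    hence "(h has_field_derivative - (inverse (f w) * deriv f w * inverse (f w))) (at w)"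
      unfolding h_def using elim(2) by (rule DERIV_inverse')
    hence "deriv h w = - deriv f w / (f w)\<^sup>2"
      by (auto dest!: DERIV_imp_deriv simp: field_simps power2_eq_square)
    thus ?case
      using elim(2) by (simp add: h_def field_simps)
  qed
qed

lemma spherical_deriv_at_pole:
  assumes nice: "f nicely_meromorphic_on {z}" and pole: "is_pole f z"
  shows   "spherical_deriv f z = cmod (deriv (\<lambda>w. inverse (f w)) z)"
proof -
  define h where "h = (\<lambda>w. inverse (f w))"
  note h = analytic_reciprocal_at_pole[OF nice pole h_def]
  have cont: "h \<midarrow>z\<rightarrow> 0" "deriv h \<midarrow>z\<rightarrow> deriv h z"
    using h(1,2) by (metis analytic_at_imp_isCont analytic_deriv isCont_def)+
  have "((\<lambda>w. cmod (deriv h w) / (1 + (cmod (h w))\<^sup>2)) \<longlongrightarrow> cmod (deriv h z) / (1 + (cmod 0)\<^sup>2)) (at z)"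
    by (intro tendsto_intros cont) auto
  also have "?this \<longleftrightarrow> ((\<lambda>w. cmod (deriv f w) / (1 + (cmod (f w))\<^sup>2)) \<longlongrightarrow>
                         cmod (deriv h z) / (1 + (cmod 0)\<^sup>2)) (at z)"
    by (rule filterlim_cong[OF refl refl], rule eventually_mono[OF h(3)])
       (auto simp: norm_divide norm_inverse norm_power field_simps add_nonneg_eq_0_iff)
  finally show ?thesis
    using pole by (simp add: spherical_deriv_def tendsto_Lim h_def)
qed

section \<open>Normalization by a rotation of the sphere\<close>

text \<open>
  The matrix with rows \<open>(\<alpha>, \<beta>)\<close> and \<open>(- cnj \<beta>, cnj \<alpha>)\<close> is a multiple of a unitary one, so it
  scales the length of \<open>(x, 1)\<close> by a constant. This is why rotations of the sphere preserve the
  spherical derivative.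
\<close>
lemma norm_rotation_pair:
  fixes \<alpha> \<beta> x :: complex
  shows "(cmod (\<alpha> * x + \<beta>))\<^sup>2 + (cmod (- cnj \<beta> * x + cnj \<alpha>))\<^sup>2
           = ((cmod \<alpha>)\<^sup>2 + (cmod \<beta>)\<^sup>2) * (1 + (cmod x)\<^sup>2)"
proof -
  have "complex_of_real ((cmod (\<alpha> * x + \<beta>))\<^sup>2 + (cmod (- cnj \<beta> * x + cnj \<alpha>))\<^sup>2)
          = of_real (((cmod \<alpha>)\<^sup>2 + (cmod \<beta>)\<^sup>2) * (1 + (cmod x)\<^sup>2))"
    unfolding of_real_add of_real_mult complex_norm_square by (simp add: algebra_simps)
  thus ?thesis
    unfolding of_real_eq_iff .
qed

lemma unit_pair_mult_cnj:
  assumes "(cmod \<alpha>)\<^sup>2 + (cmod \<beta>)\<^sup>2 = 1"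
  shows   "\<alpha> * cnj \<alpha> + \<beta> * cnj \<beta> = 1"
  using assms unfolding complex_norm_square[symmetric] by (metis of_real_1 of_real_add)

text \<open>
  Some rotation of the sphere moves the value at 0 to the point 0. For the rotated function \<open>g\<close> the
  two quotients are \<open>g\<^sup>2 / (z\<^sup>2 g')\<close> and \<open>1 / g'\<close>, so they tend to \<open>g' 0\<close> and \<open>1 / g' 0\<close>. They are written
  in terms of \<open>f\<close>, so that the poles of \<open>g\<close> never have to be considered. The letters \<open>k\<close> and \<open>l\<close> are
  the values at 0 of the two holomorphic functions used below.
\<close>
lemma rotation_to_zero:
  assumes nice: "f nicely_meromorphic_on {0}" and nz: "spherical_deriv f 0 \<noteq> 0"
  obtains \<alpha> \<beta> k l where
    "(cmod \<alpha>)\<^sup>2 + (cmod \<beta>)\<^sup>2 = 1"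
    "((\<lambda>z. moebius \<alpha> \<beta> (- cnj \<beta>) (cnj \<alpha>) (f z)) \<longlongrightarrow> 0) (at 0)"
    "((\<lambda>z. (\<alpha> * f z + \<beta>)\<^sup>2 / (z\<^sup>2 * deriv f z)) \<longlongrightarrow> k) (at 0)"
    "((\<lambda>z. (- cnj \<beta> * f z + cnj \<alpha>)\<^sup>2 / deriv f z) \<longlongrightarrow> l) (at 0)"
    "cmod k = spherical_deriv f 0" "cmod l = 1 / spherical_deriv f 0"
proof (cases "is_pole f 0")
  case True
  define h where "h = (\<lambda>w. inverse (f w))"
  note h = analytic_reciprocal_at_pole[OF nice True h_def]
  have cont: "h \<midarrow>0\<rightarrow> 0" "deriv h \<midarrow>0\<rightarrow> deriv h 0"
    using h(1,2) by (metis analytic_at_imp_isCont analytic_deriv isCont_def)+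
  have sd: "spherical_deriv f 0 = cmod (deriv h 0)"
    unfolding h_def by (rule spherical_deriv_at_pole[OF nice True])
  hence nz': "deriv h 0 \<noteq> 0"
    using nz by auto
  have "(h has_field_derivative deriv h 0) (at 0)"
    using h(1) analytic_on_imp_differentiable_at DERIV_deriv_iff_field_differentiable by blast
  hence quot: "((\<lambda>z. h z / z) \<longlongrightarrow> deriv h 0) (at 0)"
    by (simp add: has_field_derivative_iff h(2))
  \<comment> \<open>The rotation is \<open>w \<rightarrow> - 1 / w\<close>, which turns \<open>f\<close> into \<open>- h\<close>.\<close>
  show thesis
  proof (rule that[of 0 1 "- deriv h 0" "- 1 / deriv h 0"])
    have "(\<lambda>z. - h z) \<midarrow>0\<rightarrow> - 0"
      by (intro tendsto_intros cont)
    thus "(\<lambda>z. moebius 0 1 (- cnj 1) (cnj 0) (f z)) \<midarrow>0\<rightarrow> 0"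
      by (simp add: moebius_def h_def inverse_eq_divide)
    have "(\<lambda>z. - ((h z / z)\<^sup>2 / deriv h z)) \<midarrow>0\<rightarrow> - ((deriv h 0)\<^sup>2 / deriv h 0)"
      by (intro tendsto_intros quot cont nz')
    hence "(\<lambda>z. - ((h z / z)\<^sup>2 / deriv h z)) \<midarrow>0\<rightarrow> - deriv h 0"
      using nz' by (simp add: power2_eq_square)
    thus "(\<lambda>z. (0 * f z + 1)\<^sup>2 / (z\<^sup>2 * deriv f z)) \<midarrow>0\<rightarrow> - deriv h 0"
      by (rule Lim_transform_eventually, use h(3) in eventually_elim)
         (auto simp: field_simps)
    have "(\<lambda>z. - 1 / deriv h z) \<midarrow>0\<rightarrow> - 1 / deriv h 0"
      by (intro tendsto_intros cont nz')
    thus "(\<lambda>z. (- cnj 1 * f z + cnj 0)\<^sup>2 / deriv f z) \<midarrow>0\<rightarrow> - 1 / deriv h 0"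
      by (rule Lim_transform_eventually, use h(3) in eventually_elim)
         (auto simp: field_simps)
  qed (use sd in \<open>auto simp: norm_divide\<close>)
next
  case False
  define a where "a = f 0"
  define s where "s = 1 + (cmod a)\<^sup>2"
  \<comment> \<open>The rotation is \<open>w \<rightarrow> (w - a) / (1 + cnj a w)\<close>; \<open>t\<close> normalizes its coefficients.\<close>
  define t where "t = complex_of_real (1 / sqrt s)"
  have s: "s > 0"
    by (auto simp: s_def add_pos_nonneg)
  have t2: "t\<^sup>2 = 1 / of_real s"
    using s by (simp add: t_def power_divide flip: of_real_power)
  have norm_t: "(cmod t)\<^sup>2 = 1 / s"
    using t2 s by (metis norm_divide norm_of_real norm_one norm_power abs_of_pos)
  have t0: "t \<noteq> 0" "cnj t = t" and s0: "complex_of_real s \<noteq> 0"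
    using s by (auto simp: t_def)
  have s_eq: "of_real s = 1 + a * cnj a"
    by (simp add: s_def complex_norm_square flip: of_real_power)
  have f: "f analytic_on {0}"
    using nice False by (intro nicely_meromorphic_on_imp_analytic_at) auto
  have cont: "f \<midarrow>0\<rightarrow> a" "deriv f \<midarrow>0\<rightarrow> deriv f 0"
    using f unfolding a_def by (metis analytic_at_imp_isCont analytic_deriv isCont_def)+
  have sd: "spherical_deriv f 0 = cmod (deriv f 0) / s"
    using False by (simp add: spherical_deriv_def s_def a_def)
  hence nz': "deriv f 0 \<noteq> 0"
    using nz by auto
  have "(f has_field_derivative deriv f 0) (at 0)"
    using f analytic_on_imp_differentiable_at DERIV_deriv_iff_field_differentiable by blast
  hence quot: "((\<lambda>z. (f z - a) / z) \<longlongrightarrow> deriv f 0) (at 0)"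
    by (simp add: has_field_derivative_iff a_def)
  have den: "- cnj (- t * a) * a + cnj t = t * of_real s"
    by (simp add: s_eq t0 algebra_simps)
  show thesis
  proof (rule that[of t "- t * a" "t\<^sup>2 * deriv f 0" "(t * of_real s)\<^sup>2 / deriv f 0"])
    show "(cmod t)\<^sup>2 + (cmod (- t * a))\<^sup>2 = 1"
      using s by (simp add: norm_t norm_mult power_mult_distrib s_def field_simps)
    have "(\<lambda>z. (t * f z + - t * a) / (- cnj (- t * a) * f z + cnj t)) \<midarrow>0\<rightarrow>
            (t * a + - t * a) / (- cnj (- t * a) * a + cnj t)"
      by (intro tendsto_intros cont) (use den s0 t0 in simp)
    thus "(\<lambda>z. moebius t (- t * a) (- cnj (- t * a)) (cnj t) (f z)) \<midarrow>0\<rightarrow> 0"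
      by (simp add: moebius_def)
    have "(\<lambda>z. t\<^sup>2 * ((f z - a) / z)\<^sup>2 / deriv f z) \<midarrow>0\<rightarrow> t\<^sup>2 * (deriv f 0)\<^sup>2 / deriv f 0"
      by (intro tendsto_intros quot cont nz')
    moreover have "(t * f z + - t * a)\<^sup>2 = t\<^sup>2 * (f z - a)\<^sup>2" for z
      by (simp add: power2_eq_square algebra_simps)
    hence "(\<lambda>z. t\<^sup>2 * ((f z - a) / z)\<^sup>2 / deriv f z) =
             (\<lambda>z. (t * f z + - t * a)\<^sup>2 / (z\<^sup>2 * deriv f z))"
      by (simp add: fun_eq_iff power_divide)
    moreover have "t\<^sup>2 * (deriv f 0)\<^sup>2 / deriv f 0 = t\<^sup>2 * deriv f 0"
      using nz' by (simp add: power2_eq_square)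
    ultimately show "(\<lambda>z. (t * f z + - t * a)\<^sup>2 / (z\<^sup>2 * deriv f z)) \<midarrow>0\<rightarrow> t\<^sup>2 * deriv f 0"
      by (simp only:)
    have "(\<lambda>z. (- cnj (- t * a) * f z + cnj t)\<^sup>2 / deriv f z) \<midarrow>0\<rightarrow>
            (- cnj (- t * a) * a + cnj t)\<^sup>2 / deriv f 0"
      by (intro tendsto_intros cont nz')
    thus "(\<lambda>z. (- cnj (- t * a) * f z + cnj t)\<^sup>2 / deriv f z) \<midarrow>0\<rightarrow> (t * of_real s)\<^sup>2 / deriv f 0"
      unfolding den .
    show "cmod (t\<^sup>2 * deriv f 0) = spherical_deriv f 0"
      unfolding norm_mult norm_power norm_t sd by simp
    show "cmod ((t * of_real s)\<^sup>2 / deriv f 0) = 1 / spherical_deriv f 0"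
    proof -
      have "cmod ((t * of_real s)\<^sup>2 / deriv f 0) = (cmod t)\<^sup>2 * s\<^sup>2 / cmod (deriv f 0)"
        using s by (simp add: norm_mult norm_divide norm_power power_mult_distrib)
      also have "\<dots> = 1 / spherical_deriv f 0"
        unfolding norm_t sd power2_eq_square[of s] using s by simp
      finally show ?thesis .
    qed
  qed
qed

text \<open>
  The sum of the two quotients is exactly the reciprocal of the spherical derivative, for every
  rotation. So the lower bound on the spherical derivative becomes an upper bound on quantities that
  are holomorphic up to taking moduli.
\<close>
lemma local_conformal_bounds:
  assumes f: "f analytic_on {w}" and c: "c > 0" "c \<le> spherical_deriv f w"
    and unit: "(cmod \<alpha>)\<^sup>2 + (cmod \<beta>)\<^sup>2 = 1"
  shows "deriv f w \<noteq> 0"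
        "cmod ((\<alpha> * f w + \<beta>)\<^sup>2 / deriv f w) + cmod ((- cnj \<beta> * f w + cnj \<alpha>)\<^sup>2 / deriv f w) \<le> 1 / c"
proof -
  define s where "s = 1 + (cmod (f w))\<^sup>2"
  have s: "s > 0"
    by (simp add: s_def add_pos_nonneg)
  have "\<not> is_pole f w"
    using f analytic_at_imp_no_pole by blast
  hence le: "c \<le> cmod (deriv f w) / s"
    using c by (simp add: spherical_deriv_def s_def)
  thus nz: "deriv f w \<noteq> 0"
    using c by auto
  have "cmod ((\<alpha> * f w + \<beta>)\<^sup>2 / deriv f w) + cmod ((- cnj \<beta> * f w + cnj \<alpha>)\<^sup>2 / deriv f w)
          = s / cmod (deriv f w)"
    unfolding norm_divide norm_power add_divide_distrib[symmetric] norm_rotation_pair unit s_def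
    by simp
  also have "\<dots> \<le> 1 / c"
    using le s c nz by (simp add: field_simps)
  finally show "cmod ((\<alpha> * f w + \<beta>)\<^sup>2 / deriv f w) +
                  cmod ((- cnj \<beta> * f w + cnj \<alpha>)\<^sup>2 / deriv f w) \<le> 1 / c" .
qed

section \<open>A maximum principle for weighted sums of moduli\<close>

lemma obtain_aligning_phase:
  fixes x y :: complex
  obtains u where "cmod u = 1" "cmod (u * x + y) = cmod x + cmod y"
proof (cases "x = 0 \<or> y = 0")
  case True
  thus ?thesis
    by (intro that[of 1]) auto
next
  case False
  define u where "u = sgn y / sgn x"
  have "u * x = of_real (cmod x) * sgn y"
    using False by (simp add: u_def sgn_eq)
  moreover have "y = of_real (cmod y) * sgn y"
    by (simp add: sgn_eq)
  ultimately have "u * x + y = of_real (cmod x + cmod y) * sgn y"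
    by (metis distrib_right of_real_add)
  hence "cmod (u * x + y) = cmod x + cmod y"
    using False by (simp only: norm_mult norm_of_real norm_sgn) simp
  moreover have "cmod u = 1"
    using False by (simp add: u_def norm_divide norm_sgn)
  ultimately show ?thesis
    by (rule that[rotated])
qed

text \<open>
  On the circle of radius \<open>r\<close> the hypothesis bounds \<open>\<bar>r\<^sup>2 u K + L\<bar>\<close> for every unimodular \<open>u\<close>, and the
  maximum principle carries this bound to the interior. Letting \<open>r\<close> tend to 1 removes the weight,
  and the right phase \<open>u\<close> turns the modulus of the sum into the sum of the moduli. This is the step
  that transfers information from the boundary of the disc to the centre.
\<close>
lemma weighted_sum_bound_improves:
  assumes K: "K holomorphic_on ball 0 1" and L: "L holomorphic_on ball 0 1"
    and le: "\<And>z. z \<in> ball 0 1 \<Longrightarrow> (cmod z)\<^sup>2 * cmod (K z) + cmod (L z) \<le> C"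
    and z: "z \<in> ball 0 1"
  shows "cmod (K z) + cmod (L z) \<le> C"
proof -
  obtain u where u: "cmod u = 1" and dir: "cmod (u * K z + L z) = cmod (K z) + cmod (L z)"
    by (rule obtain_aligning_phase)
  have bound: "cmod (of_real (r\<^sup>2) * u * K z + L z) \<le> C" if r: "cmod z < r" "r < 1" for r
  proof (rule maximum_modulus_frontier[where S = "ball 0 r" and f = "\<lambda>z. of_real (r\<^sup>2) * u * K z + L z"])
    have sub: "cball 0 r \<subseteq> ball 0 (1::real)" "ball 0 r \<subseteq> ball (0::complex) 1" and r0: "r > 0"
      using r norm_ge_zero[of z] by (auto simp del: norm_ge_zero)
    show "(\<lambda>z. of_real (r\<^sup>2) * u * K z + L z) holomorphic_on interior (ball 0 r)"
      using sub by (auto intro!: holomorphic_intros holomorphic_on_subset[OF K] holomorphic_on_subset[OF L])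
    have "continuous_on (cball 0 r) K" "continuous_on (cball 0 r) L"
      using r by (auto intro!: holomorphic_on_imp_continuous_on holomorphic_on_subset[OF K] holomorphic_on_subset[OF L])
    thus "continuous_on (closure (ball 0 r)) (\<lambda>z. of_real (r\<^sup>2) * u * K z + L z)"
      using r0 by (auto intro!: continuous_intros)
    fix w :: complex assume "w \<in> frontier (ball 0 r)"
    hence w: "cmod w = r"
      using r0 by (simp add: frontier_ball)
    have "cmod (of_real (r\<^sup>2) * u * K w + L w) \<le> cmod (of_real (r\<^sup>2) * u * K w) + cmod (L w)"
      by (rule norm_triangle_ineq)
    also have "\<dots> = (cmod w)\<^sup>2 * cmod (K w) + cmod (L w)"
      by (simp add: norm_mult u w norm_power)
    also have "\<dots> \<le> C"
      using le[of w] w r by simp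
    finally show "cmod (of_real (r\<^sup>2) * u * K w + L w) \<le> C" .
  qed (use r in auto)
  have "((\<lambda>r. cmod (of_real (r\<^sup>2) * u * K z + L z)) \<longlongrightarrow> cmod (of_real (1\<^sup>2) * u * K z + L z)) (at_left (1::real))"
    by (intro tendsto_intros)
  moreover have "\<forall>\<^sub>F r in at_left (1::real). r \<in> {cmod z<..<1}"
    using z by (intro eventually_at_left_real) auto
  hence "\<forall>\<^sub>F r in at_left (1::real). cmod (of_real (r\<^sup>2) * u * K z + L z) \<le> C"
    by eventually_elim (use bound in auto)
  ultimately have "cmod (of_real (1\<^sup>2) * u * K z + L z) \<le> C"
    by (intro tendsto_upperbound) auto
  with dir show ?thesis
    by simp
qed

text \<open>
  A nonconstant holomorphic function is open, but the real line has empty interior.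
\<close>
lemma real_valued_imp_constant_on:
  assumes "p holomorphic_on A" "open A" "connected A" "\<And>z. z \<in> A \<Longrightarrow> p z \<in> \<real>"
  shows   "p constant_on A"
proof (rule ccontr)
  assume nc: "\<not> p constant_on A"
  hence "open (p ` A)"
    using assms by (intro open_mapping_thm[of p A A]) auto
  moreover from nc obtain z where "z \<in> A"
    by (auto simp: constant_on_def)
  hence "p z \<in> p ` A"
    by (rule imageI)
  ultimately obtain e where e: "e > 0" "ball (p z) e \<subseteq> p ` A"
    by (rule openE)
  have "p z + \<i> * of_real (e / 2) \<in> ball (p z) e"
  proof -
    have "cmod (\<i> * of_real (e / 2)) = e / 2"
      using e(1) by (simp only: norm_mult norm_of_real) simp
    thus ?thesis
      using e(1) by (simp add: dist_norm del: of_real_divide)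
  qed
  with e(2) have "p z + \<i> * of_real (e / 2) \<in> p ` A"
    by (rule subsetD)
  hence "p z + \<i> * of_real (e / 2) \<in> \<real>"
    using assms(4) by (elim imageE) simp
  hence "Im (p z) + e / 2 = 0"
    by (simp add: complex_is_Real_iff)
  moreover have "Im (p z) = 0"
    using assms(4)[OF \<open>z \<in> A\<close>] by (simp add: complex_is_Real_iff)
  ultimately show False
    using e(1) by simp
qed

text \<open>
  Equality in the triangle inequality forces the summands to have the same direction as the sum.
\<close>
lemma norm_add_extremal_imp_Reals:
  fixes x y :: complex
  assumes "cmod x + cmod y \<le> cmod (x + y)" "x + y \<noteq> 0"
  shows   "x / (x + y) \<in> \<real>"
proof -
  define p where "p = x / (x + y)"
  have "y / (x + y) = 1 - p"
    using assms(2) by (simp add: p_def field_simps)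
  moreover have "(cmod x + cmod y) / cmod (x + y) \<le> 1"
    using assms by (simp add: divide_le_eq_1)
  hence "cmod (x / (x + y)) + cmod (y / (x + y)) \<le> 1"
    unfolding norm_divide add_divide_distrib .
  ultimately have "cmod p + cmod (1 - p) \<le> 1"
    by (simp add: p_def)
  moreover have "Re p \<le> cmod p" "1 - Re p \<le> cmod (1 - p)"
    using complex_Re_le_cmod[of p] complex_Re_le_cmod[of "1 - p"] by auto
  ultimately have "cmod p = Re p"
    by linarith
  hence "Im p = 0"
    using cmod_power2[of p] by simp
  thus ?thesis
    by (simp add: p_def complex_is_Real_iff)
qed

text \<open>
  If the bound is attained at the centre, the holomorphic function \<open>u K + L\<close> attains its maximum
  there and is a constant \<open>d\<close>. The moduli of the summands then add up to at most \<open>\<bar>d\<bar>\<close> at every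
  point, so \<open>L / d\<close> is real everywhere and hence constant.
\<close>
lemma weighted_sum_bound_rigid:
  assumes K: "K holomorphic_on ball 0 1" and L: "L holomorphic_on ball 0 1"
    and le: "\<And>z. z \<in> ball 0 1 \<Longrightarrow> (cmod z)\<^sup>2 * cmod (K z) + cmod (L z) \<le> C"
    and eq: "cmod (K 0) + cmod (L 0) = C" and nz: "L 0 \<noteq> 0"
  shows "L constant_on ball 0 1"
proof -
  have bound: "cmod (K z) + cmod (L z) \<le> C" if "z \<in> ball 0 1" for z
    by (rule weighted_sum_bound_improves[OF K L _ that]) (rule le)
  obtain u where u: "cmod u = 1" and "cmod (u * K 0 + L 0) = cmod (K 0) + cmod (L 0)"
    by (rule obtain_aligning_phase)
  with eq have at0: "cmod (u * K 0 + L 0) = C"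
    by simp
  have "C > 0"
    using nz eq by (smt (verit) norm_ge_zero zero_less_norm_iff)
  have "(\<lambda>z. u * K z + L z) constant_on ball 0 1"
  proof (rule maximum_modulus_principle[where \<xi> = 0 and U = "ball 0 1"])
    fix z :: complex assume z: "z \<in> ball 0 1"
    have "cmod (u * K z + L z) \<le> cmod (u * K z) + cmod (L z)"
      by (rule norm_triangle_ineq)
    also have "\<dots> \<le> C"
      using bound[OF z] by (simp add: norm_mult u)
    finally show "cmod (u * K z + L z) \<le> cmod (u * K 0 + L 0)"
      using at0 by simp
  qed (auto intro!: holomorphic_intros K L)
  then obtain d where d: "\<And>z. z \<in> ball 0 1 \<Longrightarrow> u * K z + L z = d"
    by (auto simp: constant_on_def)
  have d': "cmod d = C" "d \<noteq> 0"
    using d[of 0] at0 \<open>C > 0\<close> by auto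
  have "(\<lambda>z. L z / d) constant_on ball 0 1"
  proof (rule real_valued_imp_constant_on)
    fix z :: complex assume z: "z \<in> ball 0 1"
    have "L z / (L z + u * K z) \<in> \<real>"
      using d[OF z] d' bound[OF z]
      by (intro norm_add_extremal_imp_Reals) (auto simp: norm_mult u add_ac)
    thus "L z / d \<in> \<real>"
      using d[OF z] by (simp add: add_ac)
  qed (use d' in \<open>auto intro!: holomorphic_intros L\<close>)
  then obtain e where "\<And>z. z \<in> ball 0 1 \<Longrightarrow> L z / d = e"
    by (auto simp: constant_on_def)
  hence "L z = e * d" if "z \<in> ball 0 1" for z
    using that d' by (force simp: field_simps)
  thus ?thesis
    by (auto simp: constant_on_def)
qed

section \<open>The central estimate and its equality case\<close>

lemma remove_sings_analytic_at_bounded: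
  assumes "F meromorphic_on {z}" "\<forall>\<^sub>F w in at z. cmod (F w) \<le> M"
  shows   "remove_sings F analytic_on {z}"
proof -
  have "\<not> is_pole F z"
  proof
    assume "is_pole F z"
    hence "\<forall>\<^sub>F w in at z. cmod (F w) \<ge> max 1 (M + 1)"
      unfolding is_pole_def filterlim_at_infinity[OF order.refl]
      by (auto dest!: spec[of _ "max 1 (M + 1)"])
    with assms(2) have "\<forall>\<^sub>F w in at z. False"
      by eventually_elim auto
    thus False
      by simp
  qed
  with assms(1) obtain c where "F \<midarrow>z\<rightarrow> c"
    unfolding meromorphic_at_iff not_essential_def by auto
  with assms(1) show ?thesis
    by (intro remove_sings_analytic_at) (auto simp: meromorphic_at_iff)
qed

text \<open>
  With \<open>g\<close> the rotated function, the maps \<open>K = g\<^sup>2 / (z\<^sup>2 g')\<close> and \<open>L = 1 / g'\<close> are bounded near every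
  point other than 0, by the local estimate, and have limits at 0. So all their singularities are
  removable. Comparing the values at 0 with the bound gives the inequality. In the case of equality \<open>L\<close> is constant, so \<open>g\<close>
  is linear, and undoing the rotation recovers \<open>f\<close>.
\<close>
lemma spherical_class_estimate:
  assumes c: "c > 0" and f: "f \<in> spherical_class c"
  defines "a \<equiv> spherical_deriv f 0"
  shows "a + 1 / a \<le> 1 / c"
    and "a + 1 / a = 1 / c \<Longrightarrow>
           \<exists>T \<eta>. rigid_motion T \<and> cmod \<eta> = a \<and> (\<forall>z\<in>unit_disc. f z = T (\<eta> * z))"
proof -
  have nice: "f nicely_meromorphic_on unit_disc"
    and ge: "\<And>z. z \<in> unit_disc \<Longrightarrow> c \<le> spherical_deriv f z"
    using f by (auto simp: spherical_class_def meromorphic_functions_disc_def)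
  have a: "a > 0"
    using ge[of 0] c by (simp add: a_def)
  have mero: "f meromorphic_on unit_disc"
    using nice by (simp add: nicely_meromorphic_on_def)
  have "f nicely_meromorphic_on {0}"
    using nice by (rule nicely_meromorphic_on_subset) simp
  then obtain \<alpha> \<beta> k l where unit: "(cmod \<alpha>)\<^sup>2 + (cmod \<beta>)\<^sup>2 = 1"
    and g0: "((\<lambda>z. moebius \<alpha> \<beta> (- cnj \<beta>) (cnj \<alpha>) (f z)) \<longlongrightarrow> 0) (at 0)"
    and k: "((\<lambda>z. (\<alpha> * f z + \<beta>)\<^sup>2 / (z\<^sup>2 * deriv f z)) \<longlongrightarrow> k) (at 0)"
    and l: "((\<lambda>z. (- cnj \<beta> * f z + cnj \<alpha>)\<^sup>2 / deriv f z) \<longlongrightarrow> l) (at 0)"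
    and norm_k: "cmod k = a" and norm_l: "cmod l = 1 / a"
    using a unfolding a_def by (elim rotation_to_zero) auto
  define K0 where "K0 = (\<lambda>z. (\<alpha> * f z + \<beta>)\<^sup>2 / (z\<^sup>2 * deriv f z))"
  define L0 where "L0 = (\<lambda>z. (- cnj \<beta> * f z + cnj \<alpha>)\<^sup>2 / deriv f z)"
  define K where "K = remove_sings K0"
  define L where "L = remove_sings L0"
  have mero_K0: "K0 meromorphic_on unit_disc" and mero_L0: "L0 meromorphic_on unit_disc"
    unfolding K0_def L0_def by (intro meromorphic_intros mero)+
  have ev: "\<forall>\<^sub>F w in at z. w \<noteq> 0 \<and> (cmod w)\<^sup>2 * cmod (K0 w) + cmod (L0 w) \<le> 1 / c"
    if z: "z \<in> unit_disc" for z
  proof -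
    have "f meromorphic_on {z}"
      using mero by (rule meromorphic_on_subset) (use z in auto)
    hence "\<forall>\<^sub>F w in at z. f analytic_on {w}"
      using isolated_singularity_at_altdef meromorphic_at_iff by blast
    moreover have "\<forall>\<^sub>F w in at z. w \<in> unit_disc"
      by (rule eventually_at_in_open') (use z in auto)
    moreover have "\<forall>\<^sub>F w in at z. w \<noteq> 0"
      by (rule eventually_neq_at_within)
    ultimately show ?thesis
    proof eventually_elim
      case (elim w)
      have "(cmod w)\<^sup>2 * cmod (K0 w) = cmod ((\<alpha> * f w + \<beta>)\<^sup>2 / deriv f w)"
        using elim by (simp add: K0_def norm_divide norm_mult norm_power)
      thus ?case
        using local_conformal_bounds(2)[OF elim(1) c ge[OF elim(2)] unit] elim(3)
        by (simp add: L0_def)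
    qed
  qed
  \<comment> \<open>Bounded singularities are removable. For \<open>K\<close> the weight degenerates at the centre, where the
     limit \<open>k\<close> is used instead.\<close>
  have ana_L: "L analytic_on {z}" if z: "z \<in> unit_disc" for z
    unfolding L_def
  proof (rule remove_sings_analytic_at_bounded)
    show "L0 meromorphic_on {z}"
      using mero_L0 by (rule meromorphic_on_subset) (use z in auto)
    show "\<forall>\<^sub>F w in at z. cmod (L0 w) \<le> 1 / c"
      using ev[OF z] by eventually_elim (smt (verit) mult_nonneg_nonneg norm_ge_zero zero_le_power2)
  qed
  have ana_K: "K analytic_on {z}" if z: "z \<in> unit_disc" for z
  proof (cases "z = 0")
    case True
    have "K0 meromorphic_on {0}"
      using mero_K0 by (rule meromorphic_on_subset) auto
    thus ?thesis
      using k True unfolding K_def K0_def[symmetric]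
      by (intro remove_sings_analytic_at) (auto simp: meromorphic_at_iff)
  next
    case False
    show ?thesis
      unfolding K_def
    proof (rule remove_sings_analytic_at_bounded)
      show "K0 meromorphic_on {z}"
        using mero_K0 by (rule meromorphic_on_subset) (use z in auto)
      have "((\<lambda>w. (cmod w)\<^sup>2) \<longlongrightarrow> (cmod z)\<^sup>2) (at z)"
        by (intro tendsto_intros)
      moreover have "(cmod z)\<^sup>2 / 2 < (cmod z)\<^sup>2"
        using False by simp
      ultimately have "\<forall>\<^sub>F w in at z. (cmod w)\<^sup>2 > (cmod z)\<^sup>2 / 2"
        by (rule order_tendstoD)
      thus "\<forall>\<^sub>F w in at z. cmod (K0 w) \<le> 1 / c / ((cmod z)\<^sup>2 / 2)"
        using ev[OF z]
      proof eventually_elim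
        case (elim w)
        have "(cmod z)\<^sup>2 / 2 * cmod (K0 w) \<le> (cmod w)\<^sup>2 * cmod (K0 w)"
          using elim by (intro mult_right_mono) auto
        also have "\<dots> \<le> 1 / c"
          using elim by (smt (verit) norm_ge_zero)
        finally show ?case
          using False by (subst pos_le_divide_eq) (auto simp: mult.commute)
      qed
    qed
  qed
  have hol: "K holomorphic_on ball 0 1" "L holomorphic_on ball 0 1"
    using ana_K ana_L analytic_on_analytic_at analytic_imp_holomorphic by blast+
  have le: "(cmod z)\<^sup>2 * cmod (K z) + cmod (L z) \<le> 1 / c" if z: "z \<in> ball 0 1" for z
  proof (rule tendsto_upperbound)
    have "K \<midarrow>z\<rightarrow> K z" "L \<midarrow>z\<rightarrow> L z"
      using ana_K[OF z] ana_L[OF z] by (metis analytic_at_imp_isCont isCont_def)+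
    thus "((\<lambda>w. (cmod w)\<^sup>2 * cmod (K w) + cmod (L w)) \<longlongrightarrow> (cmod z)\<^sup>2 * cmod (K z) + cmod (L z)) (at z)"
      by (intro tendsto_intros)
    have "isolated_singularity_at K0 z" "isolated_singularity_at L0 z"
      using mero_K0 mero_L0 z by (auto simp: meromorphic_on_altdef)
    hence "\<forall>\<^sub>F w in at z. K w = K0 w" "\<forall>\<^sub>F w in at z. L w = L0 w"
      unfolding K_def L_def by (simp_all add: eventually_remove_sings_eq_at)
    thus "\<forall>\<^sub>F w in at z. (cmod w)\<^sup>2 * cmod (K w) + cmod (L w) \<le> 1 / c"
      using ev[OF z] by eventually_elim auto
  qed auto
  have K_0: "K 0 = k" and L_0: "L 0 = l"
    using k l by (auto simp: K_def L_def K0_def L0_def)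
  show "a + 1 / a \<le> 1 / c"
    using weighted_sum_bound_improves[OF hol le, of 0] by (simp add: K_0 L_0 norm_k norm_l)

  assume eq: "a + 1 / a = 1 / c"
  have l0: "l \<noteq> 0"
    using norm_l a by auto
  have "L constant_on ball 0 1"
  proof (rule weighted_sum_bound_rigid[OF hol])
    show "cmod (K 0) + cmod (L 0) = 1 / c"
      unfolding K_0 L_0 norm_k norm_l by (rule eq)
  qed (use le l0 L_0 in auto)
  hence L_eq: "L z = l" if "z \<in> ball 0 1" for z
    using that L_0 unfolding constant_on_def by (metis centre_in_ball zero_less_one)

  \<comment> \<open>The poles form a sparse set, so their complement is still connected and the constant
     derivative of \<open>g\<close> can be integrated there.\<close>
  define P where "P = {w. \<not> f analytic_on {w}}"
  have P: "P sparse_in unit_disc"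
    unfolding P_def by (rule meromorphic_on_imp_sparse_singularities[OF mero])
  hence dom: "open (unit_disc - P)" "connected (unit_disc - P)"
    by (auto intro!: open_diff_sparse_pts sparse_imp_connected)
  have den: "(- cnj \<beta> * f w + cnj \<alpha>)\<^sup>2 = l * deriv f w" "- cnj \<beta> * f w + cnj \<alpha> \<noteq> 0"
    if w: "w \<in> unit_disc - P" for w
  proof -
    have f_ana: "f analytic_on {w}"
      using w by (simp add: P_def)
    have nz: "deriv f w \<noteq> 0"
      using w by (intro local_conformal_bounds(1)[OF f_ana c ge unit]) auto
    have "L0 analytic_on {w}"
      unfolding L0_def using nz by (intro analytic_intros f_ana analytic_deriv) auto
    hence "L0 w = l"
      using L_eq[of w] w by (simp add: L_def)
    thus "(- cnj \<beta> * f w + cnj \<alpha>)\<^sup>2 = l * deriv f w"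
      using nz by (simp add: L0_def field_simps)
    with nz l0 show "- cnj \<beta> * f w + cnj \<alpha> \<noteq> 0"
      by auto
  qed
  define g where "g = (\<lambda>w. moebius \<alpha> \<beta> (- cnj \<beta>) (cnj \<alpha>) (f w))"
  define \<eta> where "\<eta> = 1 / l"
  have unit': "\<alpha> * cnj \<alpha> + \<beta> * cnj \<beta> = 1"
    by (rule unit_pair_mult_cnj[OF unit])
  have deriv_g: "((\<lambda>w. g w - \<eta> * w) has_field_derivative 0) (at w)" if w: "w \<in> unit_disc - P" for w
  proof -
    define d where "d = - cnj \<beta> * f w + cnj \<alpha>"
    have "f analytic_on {w}"
      using w by (simp add: P_def)
    hence f_der: "(f has_field_derivative deriv f w) (at w)"
      using analytic_on_imp_differentiable_at DERIV_deriv_iff_field_differentiable by blast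
    have "(g has_field_derivative
            ((\<alpha> * deriv f w) * d - (\<alpha> * f w + \<beta>) * (- cnj \<beta> * deriv f w)) / (d * d)) (at w)"
      unfolding g_def moebius_def d_def using den(2)[OF w]
      by (auto intro!: derivative_eq_intros f_der)
    \<comment> \<open>The matrix of the rotation has determinant 1, so \<open>g' = f' / d\<^sup>2 = 1 / L\<close>.\<close>
    also have "(\<alpha> * deriv f w) * d - (\<alpha> * f w + \<beta>) * (- cnj \<beta> * deriv f w)
                 = (\<alpha> * cnj \<alpha> + \<beta> * cnj \<beta>) * deriv f w"
      by (simp add: d_def algebra_simps)
    also have "\<dots> / (d * d) = \<eta>"
    proof -
      have "d * d = l * deriv f w" "d \<noteq> 0"
        using den[OF w] by (simp_all add: d_def power2_eq_square)
      moreover from this have "deriv f w \<noteq> 0"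
        by auto
      ultimately show ?thesis
        unfolding unit' \<eta>_def by simp
    qed
    finally show ?thesis
      by (auto intro!: derivative_eq_intros)
  qed
  have const: "g w - \<eta> * w = g v - \<eta> * v" if "w \<in> unit_disc - P" "v \<in> unit_disc - P" for v w
    by (rule has_derivative_zero_unique_connected[OF dom _ that])
       (use deriv_g in \<open>simp add: has_field_derivative_def lambda_zero\<close>)
  have "\<exists>e. \<forall>w\<in>unit_disc - P. g w - \<eta> * w = e"
    using const by (cases "unit_disc - P = {}") blast+
  then obtain e where e: "g w - \<eta> * w = e" if "w \<in> unit_disc - P" for w
    by blast
  have ev_dom: "\<forall>\<^sub>F w in at z. w \<in> unit_disc - P" if "z \<in> unit_disc" for z
  proof -
    have "\<forall>\<^sub>F w in at z. w \<notin> P"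
      using P that sparse_in_eventually_iff[of unit_disc P] by auto
    moreover have "\<forall>\<^sub>F w in at z. w \<in> unit_disc"
      by (rule eventually_at_in_open') (use that in auto)
    ultimately show ?thesis
      by eventually_elim auto
  qed
  have "((\<lambda>w. g w - \<eta> * w) \<longlongrightarrow> 0 - \<eta> * 0) (at 0)"
    unfolding g_def by (intro tendsto_intros g0)
  moreover have "((\<lambda>w. g w - \<eta> * w) \<longlongrightarrow> e) (at 0)"
    by (rule tendsto_eventually, rule eventually_mono[OF ev_dom]) (use e in auto)
  ultimately have "e = 0"
    using tendsto_unique[of "at 0"] by force
  hence g_eq: "g w = \<eta> * w" if "w \<in> unit_disc - P" for w
    using e[OF that] by simp
  define T where "T = moebius (cnj \<alpha>) (- \<beta>) (cnj \<beta>) \<alpha>"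
  have "rigid_motion T"
    unfolding rigid_motion_def T_def
    by (rule exI[of _ "cnj \<alpha>"], rule exI[of _ "- \<beta>"]) (use unit in simp)
  moreover have f_eq: "f w = T (\<eta> * w)" if w: "w \<in> unit_disc - P" for w
  proof -
    have "\<alpha> * cnj \<alpha> \<noteq> \<beta> * - cnj \<beta>"
      using unit' by (metis add.inverse_inverse mult_minus_right neg_eq_iff_add_eq_0 zero_neq_one)
    from moebius_inverse[OF this den(2)[OF w]] show ?thesis
      unfolding g_eq[OF w, symmetric] T_def g_def by simp
  qed
  \<comment> \<open>At a pole of \<open>f\<close> the denominator of \<open>T\<close> has to vanish, because otherwise \<open>f\<close> would have a finite
     limit. So both sides take the default value 0.\<close>
  moreover have "f p = T (\<eta> * p)" if p: "p \<in> unit_disc" "p \<in> P" for p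
  proof -
    have pole: "is_pole f p"
      using nicely_meromorphic_on_imp_analytic_at[OF nice p(1)] p(2) by (auto simp: P_def)
    have "cnj \<beta> * (\<eta> * p) + \<alpha> = 0"
    proof (rule ccontr)
      assume nz: "cnj \<beta> * (\<eta> * p) + \<alpha> \<noteq> 0"
      have "((\<lambda>w. T (\<eta> * w)) \<longlongrightarrow> T (\<eta> * p)) (at p)"
        unfolding T_def moebius_def by (intro tendsto_intros nz)
      hence "(f \<longlongrightarrow> T (\<eta> * p)) (at p)"
        by (rule Lim_transform_eventually) (rule eventually_mono[OF ev_dom[OF p(1)]], use f_eq in auto)
      with pole show False
        unfolding is_pole_def using not_tendsto_and_filterlim_at_infinity by (metis at_neq_bot)
    qed
    thus ?thesis
      using is_pole_zero_at_nicely_mero[OF nice pole p(1)] by (simp add: T_def moebius_def)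
  qed
  moreover have "cmod \<eta> = a"
    by (simp add: \<eta>_def norm_divide norm_l)
  ultimately show "\<exists>T \<eta>. rigid_motion T \<and> cmod \<eta> = a \<and> (\<forall>z\<in>unit_disc. f z = T (\<eta> * z))"
    by (intro exI[of _ T] exI[of _ \<eta>]) blast
qed

section \<open>The spherical geometry of rigid motions\<close>

text \<open>
  Away from the pole of \<open>T (\<eta> z)\<close> the determinant 1 of \<open>T\<close> gives the derivative \<open>\<eta> / d\<^sup>2\<close>, where \<open>d\<close> is
  the denominator, and \<open>norm_rotation_pair\<close> cancels \<open>d\<close>. The resulting formula is continuous at the pole
  too, which settles the value there.
\<close>
lemma
  assumes T: "rigid_motion T" and \<eta>: "\<eta> \<noteq> 0"
  shows spherical_deriv_rigid_motion_scaled: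
          "spherical_deriv (\<lambda>z. T (\<eta> * z)) z = cmod \<eta> / (1 + (cmod (\<eta> * z))\<^sup>2)"
    and nicely_meromorphic_rigid_motion_scaled: "(\<lambda>z. T (\<eta> * z)) nicely_meromorphic_on A"
proof -
  obtain \<alpha> \<beta> where unit: "(cmod \<alpha>)\<^sup>2 + (cmod \<beta>)\<^sup>2 = 1" and T_eq: "T = moebius \<alpha> \<beta> (- cnj \<beta>) (cnj \<alpha>)"
    using T by (auto simp: rigid_motion_def)
  have unit': "\<alpha> * cnj \<alpha> + \<beta> * cnj \<beta> = 1"
    by (rule unit_pair_mult_cnj[OF unit])
  define n where "n = (\<lambda>z. \<alpha> * (\<eta> * z) + \<beta>)"
  define d where "d = (\<lambda>z. - cnj \<beta> * (\<eta> * z) + cnj \<alpha>)"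
  define S where "S = (\<lambda>z. T (\<eta> * z))"
  have S_eq: "S = (\<lambda>z. n z / d z)"
    by (simp add: S_def T_eq moebius_def n_def d_def)
  have sum: "(cmod (n z))\<^sup>2 + (cmod (d z))\<^sup>2 = 1 + (cmod (\<eta> * z))\<^sup>2" for z
    unfolding n_def d_def norm_rotation_pair unit by simp
  have ana: "S analytic_on {z}" if "d z \<noteq> 0" for z
    unfolding S_eq using that by (auto simp: n_def d_def intro!: analytic_intros)
  have val: "cmod (deriv S z) / (1 + (cmod (S z))\<^sup>2) = cmod \<eta> / (1 + (cmod (\<eta> * z))\<^sup>2)"
    if nz: "d z \<noteq> 0" for z
  proof -
    have "(S has_field_derivative (\<alpha> * \<eta> * d z - n z * (- cnj \<beta> * \<eta>)) / (d z * d z)) (at z)"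
      unfolding S_eq using nz unfolding n_def d_def
      by (auto intro!: derivative_eq_intros)
    also have "\<alpha> * \<eta> * d z - n z * (- cnj \<beta> * \<eta>) = (\<alpha> * cnj \<alpha> + \<beta> * cnj \<beta>) * \<eta>"
      by (simp add: n_def d_def algebra_simps)
    finally have "deriv S z = \<eta> / (d z)\<^sup>2"
      unfolding unit' by (auto dest!: DERIV_imp_deriv simp: power2_eq_square)
    hence norm_deriv: "cmod (deriv S z) = cmod \<eta> / (cmod (d z))\<^sup>2"
      by (simp add: norm_divide norm_power)
    have "cmod (deriv S z) / (1 + (cmod (S z))\<^sup>2) = cmod \<eta> / ((cmod (n z))\<^sup>2 + (cmod (d z))\<^sup>2)"
      unfolding norm_deriv using nz by (simp add: S_eq norm_divide power_divide field_simps)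
    thus ?thesis
      unfolding sum .
  qed
  have at_zero: "is_pole S z \<and> (\<forall>\<^sub>F w in at z. d w \<noteq> 0)" if dz: "d z = 0" for z
  proof -
    have n: "n z \<noteq> 0"
      using sum[of z] dz by (auto simp: add_nonneg_eq_0_iff)
    have \<beta>: "\<beta> \<noteq> 0"
      using dz unit by (auto simp: d_def)
    have "d w = - cnj \<beta> * \<eta> * (w - z)" for w
      using dz by (simp add: d_def algebra_simps)
    hence "d w \<noteq> 0" if "w \<noteq> z" for w
      using that \<beta> \<eta> by simp
    hence ev: "\<forall>\<^sub>F w in at z. d w \<noteq> 0"
      by (auto simp: eventually_at_filter)
    have "(d \<longlongrightarrow> d z) (at z)"
      unfolding d_def by (intro tendsto_intros)
    hence "filterlim d (at 0) (at z)"
      using ev dz by (simp add: filterlim_at)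
    moreover have "isCont n z"
      unfolding n_def by (intro continuous_intros)
    ultimately have "is_pole S z"
      unfolding S_eq using n by (intro is_pole_divide)
    with ev show ?thesis by simp
  qed
  show "spherical_deriv (\<lambda>z. T (\<eta> * z)) z = cmod \<eta> / (1 + (cmod (\<eta> * z))\<^sup>2)"
    unfolding S_def[symmetric]
  proof (cases "d z = 0")
    case False
    hence "\<not> is_pole S z"
      using ana analytic_at_imp_no_pole by blast
    with val[OF False] show "spherical_deriv S z = cmod \<eta> / (1 + (cmod (\<eta> * z))\<^sup>2)"
      by (simp add: spherical_deriv_def)
  next
    case True
    have "((\<lambda>w. cmod \<eta> / (1 + (cmod (\<eta> * w))\<^sup>2)) \<longlongrightarrow> cmod \<eta> / (1 + (cmod (\<eta> * z))\<^sup>2)) (at z)"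
      by (intro tendsto_intros) (smt (verit) zero_le_power2)
    hence "((\<lambda>w. cmod (deriv S w) / (1 + (cmod (S w))\<^sup>2)) \<longlongrightarrow> cmod \<eta> / (1 + (cmod (\<eta> * z))\<^sup>2)) (at z)"
      by (rule Lim_transform_eventually)
         (rule eventually_mono[OF conjunct2[OF at_zero[OF True]]], simp add: val)
    thus "spherical_deriv S z = cmod \<eta> / (1 + (cmod (\<eta> * z))\<^sup>2)"
      using at_zero[OF True] by (simp add: spherical_deriv_def tendsto_Lim)
  qed
  have "(is_pole S z \<and> S z = 0) \<or> S \<midarrow>z\<rightarrow> S z" for z
    using ana[of z] at_zero[of z] analytic_at_imp_isCont[of S z]
    by (cases "d z = 0") (auto simp: S_eq isCont_def)
  moreover have "S meromorphic_on A"
    unfolding S_eq n_def d_def by (intro meromorphic_intros)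
  ultimately show "(\<lambda>z. T (\<eta> * z)) nicely_meromorphic_on A"
    unfolding S_def[symmetric] nicely_meromorphic_on_def by blast
qed

lemma spherical_deriv_rigid_motion_on_disc:
  assumes "rigid_motion T" "\<eta> \<noteq> 0" "\<forall>z\<in>unit_disc. f z = T (\<eta> * z)" "z \<in> unit_disc"
  shows   "spherical_deriv f z = cmod \<eta> / (1 + (cmod (\<eta> * z))\<^sup>2)"
proof -
  have "\<forall>\<^sub>F w in nhds z. w \<in> unit_disc"
    using assms(4) by (intro eventually_nhds_in_open) auto
  hence "\<forall>\<^sub>F w in nhds z. f w = T (\<eta> * w)"
    by eventually_elim (use assms(3) in auto)
  from spherical_deriv_cong[OF this] show ?thesis
    using spherical_deriv_rigid_motion_scaled[OF assms(1,2)] by simp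
qed

lemma rigid_motion_in_spherical_class:
  assumes T: "rigid_motion T" and \<eta>: "cmod \<eta> = 1" and eq: "\<forall>z\<in>unit_disc. g z = T (\<eta> * z)"
  shows   "g \<in> spherical_class (1/2)"
proof -
  have nz: "\<eta> \<noteq> 0"
    using \<eta> by auto
  have "g nicely_meromorphic_on unit_disc"
    by (rule nicely_meromorphic_on_cong_open[OF nicely_meromorphic_rigid_motion_scaled[OF T nz]])
       (use eq in auto)
  moreover have "1/2 \<le> spherical_deriv g z" if z: "z \<in> unit_disc" for z
  proof -
    have "(cmod z)\<^sup>2 \<le> 1"
      using z by (simp add: power_le_one)
    hence "1/2 \<le> 1 / (1 + (cmod z)\<^sup>2)"
      by (intro divide_left_mono) (auto intro: add_pos_nonneg)
    thus ?thesis
      unfolding spherical_deriv_rigid_motion_on_disc[OF T nz eq z] by (simp add: \<eta> norm_mult)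
  qed
  ultimately show ?thesis
    by (simp add: spherical_class_def meromorphic_functions_disc_def)
qed

text \<open>
  The rotation \<open>z \<rightarrow> \<eta> z\<close> is itself a rigid motion, but its matrix has determinant 1 only after
  dividing by a square root \<open>\<mu>\<close> of \<open>\<eta>\<close>.
\<close>
lemma rigid_motion_precompose_rotation:
  assumes T: "rigid_motion T" and \<eta>: "cmod \<eta> = 1"
  shows   "rigid_motion (\<lambda>z. T (\<eta> * z))"
proof -
  obtain \<alpha> \<beta> where unit: "(cmod \<alpha>)\<^sup>2 + (cmod \<beta>)\<^sup>2 = 1" and T_eq: "T = moebius \<alpha> \<beta> (- cnj \<beta>) (cnj \<alpha>)"
    using T by (auto simp: rigid_motion_def)
  define \<mu> where "\<mu> = csqrt \<eta>"
  have \<mu>2: "\<mu> * \<mu> = \<eta>"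
    using power2_csqrt[of \<eta>] by (simp add: \<mu>_def power2_eq_square)
  have norm_\<mu>: "cmod \<mu> = 1"
    using \<eta> by (simp add: \<mu>_def)
  hence \<mu>: "cnj \<mu> * \<mu> = 1" "\<mu> \<noteq> 0"
    using complex_norm_square[of \<mu>] by (auto simp: mult.commute)
  have "T (\<eta> * z) = moebius (\<alpha> * \<mu>) (\<beta> * cnj \<mu>) (- cnj (\<beta> * cnj \<mu>)) (cnj (\<alpha> * \<mu>)) z" for z
  proof -
    have "moebius (\<alpha> * \<mu>) (\<beta> * cnj \<mu>) (- cnj (\<beta> * cnj \<mu>)) (cnj (\<alpha> * \<mu>)) z
            = (\<mu> * (\<alpha> * \<mu> * z + \<beta> * cnj \<mu>)) / (\<mu> * (- cnj \<beta> * \<mu> * z + cnj \<alpha> * cnj \<mu>))"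
      using \<mu>(2) by (simp add: moebius_def)
    also have "\<mu> * (\<alpha> * \<mu> * z + \<beta> * cnj \<mu>) = \<alpha> * (\<mu> * \<mu>) * z + \<beta> * (cnj \<mu> * \<mu>)"
      by (simp add: algebra_simps)
    also have "\<mu> * (- cnj \<beta> * \<mu> * z + cnj \<alpha> * cnj \<mu>) = - cnj \<beta> * (\<mu> * \<mu>) * z + cnj \<alpha> * (cnj \<mu> * \<mu>)"
      by (simp add: algebra_simps)
    finally show ?thesis
      unfolding \<mu> \<mu>2 by (simp add: T_eq moebius_def mult.assoc)
  qed
  thus ?thesis
    unfolding rigid_motion_def using unit norm_\<mu>
    by (intro exI[of _ "\<alpha> * \<mu>"] exI[of _ "\<beta> * cnj \<mu>"]) (auto simp: norm_mult)
qed

section \<open>Sharp bounds for the spherical derivative at the centre\<close>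

text \<open>
  The hypothesis is the quadratic inequality \<open>c a\<^sup>2 - a + c \<le> 0\<close>, so \<open>a\<close> lies between the two roots of
  this polynomial. A root exists only if the discriminant \<open>1 - 4 c\<^sup>2\<close> is nonnegative.
\<close>
lemma reciprocal_sum_bounds:
  fixes a c :: real
  assumes c: "c > 0" and a: "a > 0" and le: "a + 1 / a \<le> 1 / c"
  shows "c \<le> 1/2"
    and "a \<le> (1 + sqrt (1 - 4 * c\<^sup>2)) / (2 * c)"
    and "a \<ge> (1 - sqrt (1 - 4 * c\<^sup>2)) / (2 * c)"
    and "c = 1/2 \<Longrightarrow> a = 1"
    and "a = (1 + sqrt (1 - 4 * c\<^sup>2)) / (2 * c) \<or> a = (1 - sqrt (1 - 4 * c\<^sup>2)) / (2 * c)
           \<Longrightarrow> a + 1 / a = 1 / c"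
proof -
  have diff: "(2 * c * a - 1)\<^sup>2 - (1 - 4 * c\<^sup>2) = 4 * c\<^sup>2 * a * (a + 1 / a - 1 / c)"
    using a c by (simp add: field_simps power2_eq_square)
  also have "\<dots> \<le> 0"
    using le a c by (intro mult_nonneg_nonpos) auto
  finally have sq: "(2 * c * a - 1)\<^sup>2 \<le> 1 - 4 * c\<^sup>2"
    by simp
  have disc: "0 \<le> 1 - 4 * c\<^sup>2"
    using sq zero_le_power2[of "2 * c * a - 1"] by linarith
  hence "(2 * c)\<^sup>2 \<le> 1\<^sup>2"
    by (simp add: power_mult_distrib)
  hence "2 * c \<le> 1"
    by (rule power2_le_imp_le) simp
  thus "c \<le> 1/2"
    by simp
  have abs: "\<bar>2 * c * a - 1\<bar> \<le> sqrt (1 - 4 * c\<^sup>2)"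
    using sq by (rule real_le_rsqrt[OF order.trans[OF eq_refl[OF power2_abs]]])
  thus "a \<le> (1 + sqrt (1 - 4 * c\<^sup>2)) / (2 * c)" "a \<ge> (1 - sqrt (1 - 4 * c\<^sup>2)) / (2 * c)"
    using c by (auto simp: field_simps abs_le_iff)
  show "a = 1" if "c = 1/2"
    using abs that by (simp add: power_divide)
  assume "a = (1 + sqrt (1 - 4 * c\<^sup>2)) / (2 * c) \<or> a = (1 - sqrt (1 - 4 * c\<^sup>2)) / (2 * c)"
  hence "2 * c * a - 1 = sqrt (1 - 4 * c\<^sup>2) \<or> 2 * c * a - 1 = - sqrt (1 - 4 * c\<^sup>2)"
    using c by auto
  hence "(2 * c * a - 1)\<^sup>2 = 1 - 4 * c\<^sup>2"
    using disc by auto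
  with diff have "4 * c\<^sup>2 * a * (a + 1 / a - 1 / c) = 0"
    by simp
  thus "a + 1 / a = 1 / c"
    using a c by simp
qed

lemma spherical_deriv_0_pos:
  assumes "c > 0" "f \<in> spherical_class c"
  shows   "spherical_deriv f 0 > 0"
proof -
  have "c \<le> spherical_deriv f 0"
    using assms(2) by (simp add: spherical_class_def)
  with assms(1) show ?thesis
    by simp
qed

theorem theorem1p1:
  shows
    "(\<forall>(c::real) f. c > 0 \<and> f \<in> spherical_class c \<longrightarrow>
        c \<le> 1/2
      \<and> spherical_deriv f 0 \<le> (1 + sqrt (1 - 4 * c\<^sup>2)) / (2 * c)
      \<and> spherical_deriv f 0 \<ge> (1 - sqrt (1 - 4 * c\<^sup>2)) / (2 * c)
      \<and> (c = 1/2 \<longrightarrow>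
           (\<exists>T \<eta>. rigid_motion T \<and> cmod \<eta> = 1 \<and> (\<forall>z\<in>unit_disc. f z = T (\<eta> * z))))
      \<and> (spherical_deriv f 0 = (1 + sqrt (1 - 4 * c\<^sup>2)) / (2 * c) \<longleftrightarrow>
           (\<exists>T \<eta>. rigid_motion T \<and> cmod \<eta> = (1 + sqrt (1 - 4 * c\<^sup>2)) / (2 * c) \<and>
                  (\<forall>z\<in>unit_disc. f z = T (\<eta> * z))))
      \<and> (spherical_deriv f 0 = (1 - sqrt (1 - 4 * c\<^sup>2)) / (2 * c) \<longleftrightarrow>
           (\<exists>T \<eta>. rigid_motion T \<and> cmod \<eta> = (1 - sqrt (1 - 4 * c\<^sup>2)) / (2 * c) \<and>
                  (\<forall>z\<in>unit_disc. f z = T (\<eta> * z)))))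
   \<and> (\<forall>g T \<eta>. rigid_motion T \<and> cmod \<eta> = 1 \<and> (\<forall>z\<in>unit_disc. g z = T (\<eta> * z)) \<longrightarrow>
        g \<in> spherical_class (1/2))
   \<and> (\<forall>g. g \<in> spherical_class (1/2) \<longleftrightarrow>
        (\<exists>T. rigid_motion T \<and> (\<forall>z\<in>unit_disc. g z = T z)))"
proof (intro conjI allI impI; (elim conjE)?)
  have extremal: "spherical_deriv f 0 = x \<longleftrightarrow>
      (\<exists>T \<eta>. rigid_motion T \<and> cmod \<eta> = x \<and> (\<forall>z\<in>unit_disc. f z = T (\<eta> * z)))"
    if c: "c > 0" and f: "f \<in> spherical_class c"
      and x: "x = (1 + sqrt (1 - 4 * c\<^sup>2)) / (2 * c) \<or> x = (1 - sqrt (1 - 4 * c\<^sup>2)) / (2 * c)"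
    for c x :: real and f
  proof
    assume sd: "spherical_deriv f 0 = x"
    have "spherical_deriv f 0 > 0"
      using spherical_deriv_0_pos[OF c f] .
    hence "spherical_deriv f 0 + 1 / spherical_deriv f 0 = 1 / c"
      using reciprocal_sum_bounds(5)[OF c _ spherical_class_estimate(1)[OF c f]] x sd by simp
    from spherical_class_estimate(2)[OF c f this] sd
    show "\<exists>T \<eta>. rigid_motion T \<and> cmod \<eta> = x \<and> (\<forall>z\<in>unit_disc. f z = T (\<eta> * z))"
      by simp
  next
    assume "\<exists>T \<eta>. rigid_motion T \<and> cmod \<eta> = x \<and> (\<forall>z\<in>unit_disc. f z = T (\<eta> * z))"
    then obtain T \<eta> where T: "rigid_motion T" "cmod \<eta> = x" "\<forall>z\<in>unit_disc. f z = T (\<eta> * z)"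
      by blast
    \<comment> \<open>The smaller root is still positive, so \<open>\<eta>\<close> is not 0 and \<open>f\<close> is not constant.\<close>
    have "sqrt (1 - 4 * c\<^sup>2) < 1"
      using c by simp
    moreover have "0 \<le> sqrt (1 - 4 * c\<^sup>2)"
      using reciprocal_sum_bounds(1)[OF c spherical_deriv_0_pos[OF c f] spherical_class_estimate(1)[OF c f]]
        c power_mono[of c "1/2" 2] by (simp add: power_divide)
    ultimately have "x > 0"
      using x c by (auto intro!: divide_pos_pos add_pos_nonneg)
    hence "\<eta> \<noteq> 0"
      using T(2) by auto
    from spherical_deriv_rigid_motion_on_disc[OF T(1) this T(3), of 0] T(2)
    show "spherical_deriv f 0 = x"
      by simp
  qed
  have attained: "\<exists>T \<eta>. rigid_motion T \<and> cmod \<eta> = 1 \<and> (\<forall>z\<in>unit_disc. f z = T (\<eta> * z))"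
    if f: "f \<in> spherical_class (1/2)" for f
  proof -
    have half_pos: "(1/2 :: real) > 0"
      by simp
    have "spherical_deriv f 0 = 1"
      using reciprocal_sum_bounds(4)[OF half_pos spherical_deriv_0_pos[OF half_pos f]
              spherical_class_estimate(1)[OF half_pos f]] by simp
    with extremal[OF _ f, of 1] show ?thesis
      by (simp add: power_divide)
  qed
  {
    fix c :: real and f assume c: "c > 0" and f: "f \<in> spherical_class c"
    note bounds = reciprocal_sum_bounds[OF c spherical_deriv_0_pos[OF c f] spherical_class_estimate(1)[OF c f]]
    show "c \<le> 1/2"
      "spherical_deriv f 0 \<le> (1 + sqrt (1 - 4 * c\<^sup>2)) / (2 * c)"
      "spherical_deriv f 0 \<ge> (1 - sqrt (1 - 4 * c\<^sup>2)) / (2 * c)"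
      by (rule bounds)+
    show "spherical_deriv f 0 = (1 + sqrt (1 - 4 * c\<^sup>2)) / (2 * c) \<longleftrightarrow>
           (\<exists>T \<eta>. rigid_motion T \<and> cmod \<eta> = (1 + sqrt (1 - 4 * c\<^sup>2)) / (2 * c) \<and>
                  (\<forall>z\<in>unit_disc. f z = T (\<eta> * z)))"
      by (rule extremal[OF c f]) simp
    show "spherical_deriv f 0 = (1 - sqrt (1 - 4 * c\<^sup>2)) / (2 * c) \<longleftrightarrow>
           (\<exists>T \<eta>. rigid_motion T \<and> cmod \<eta> = (1 - sqrt (1 - 4 * c\<^sup>2)) / (2 * c) \<and>
                  (\<forall>z\<in>unit_disc. f z = T (\<eta> * z)))"
      by (rule extremal[OF c f]) simp
    show "\<exists>T \<eta>. rigid_motion T \<and> cmod \<eta> = 1 \<and> (\<forall>z\<in>unit_disc. f z = T (\<eta> * z))" if "c = 1/2"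
      using attained f that by simp
  }
  show "g \<in> spherical_class (1/2)"
    if "rigid_motion T" "cmod \<eta> = 1" "\<forall>z\<in>unit_disc. g z = T (\<eta> * z)" for g T \<eta>
    using that by (rule rigid_motion_in_spherical_class)
  show "g \<in> spherical_class (1/2) \<longleftrightarrow> (\<exists>T. rigid_motion T \<and> (\<forall>z\<in>unit_disc. g z = T z))" for g
  proof
    assume "g \<in> spherical_class (1/2)"
    from attained[OF this] show "\<exists>T. rigid_motion T \<and> (\<forall>z\<in>unit_disc. g z = T z)"
      using rigid_motion_precompose_rotation by blast
  next
    assume "\<exists>T. rigid_motion T \<and> (\<forall>z\<in>unit_disc. g z = T z)"
    thus "g \<in> spherical_class (1/2)"
      using rigid_motion_in_spherical_class[where \<eta> = 1] by auto
  qed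
qed

end
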